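(* Let $\mathcal H$ be a complex Hilbert space, let $m\ge1$ be an integer, and let $T\in\mathcal B(\mathcal H)$. Then: (i) $T$ is similar to an $m$-isometry if and only if there exists an equivalent Hilbert norm on $\mathcal H$ such that $T$ is an $m$-isometry with respect to this norm; (ii) $T$ is similar to an $m$-partial isometry if and only if there exists an equivalent Hilbert norm on $\mathcal H$ such that $T$ is an $m$-partial isometry with respect to this norm.
   Context: $\mathcal B(\mathcal H)$ denotes the bounded linear operators on $\mathcal H$. For $T\in\mathcal B(\mathcal H)$ and an integer $m\ge1$, let $\beta_m(T)=\sum_{k=0}^m(-1)^{m-k}\binom mk T^{*k}T^k$. $T$ is an $m$-isometry if $\beta_m(T)=0$, and an $m$-partial isometry if $T\beta_m(T)=0$. An equivalent Hilbert norm on $\mathcal H$ is a norm induced by an inner product on $\mathcal H$ and equivalent to the original norm; $T$ is an $m$-isometry (respectively, $m$-partial isometry) with respect to it if the defining identity holds with the adjoint $T^*$ replaced by the adjoint of $T$ for the new inner product. Two operators $A,B\in\mathcal B(\mathcal H)$ are similar if $A=P^{-1}BP$ for some invertible $P\in\mathcal B(\mathcal H)$. *)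

theory Defs
  imports "HOL-Analysis.Analysis"
begin

class complex_vector = real_vector +
  fixes scaleC :: "complex \<Rightarrow> 'a \<Rightarrow> 'a" (infixr "*\<^sub>C" 75)
  assumes scaleC_add_right: "a *\<^sub>C (x + y) = a *\<^sub>C x + a *\<^sub>C y"
    and scaleC_add_left: "(a + b) *\<^sub>C x = a *\<^sub>C x + b *\<^sub>C x"
    and scaleC_scaleC: "a *\<^sub>C (b *\<^sub>C x) = (a * b) *\<^sub>C x"
    and scaleR_scaleC: "r *\<^sub>R x = complex_of_real r *\<^sub>C x"

lemma vector_space_scaleC: "vector_space (scaleC :: complex \<Rightarrow> 'a \<Rightarrow> 'a::complex_vector)"
proof
  fix x :: 'a
  show "1 *\<^sub>C x = x"
    using scaleR_scaleC[of 1 x] by simp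
qed (simp_all add: scaleC_add_right scaleC_add_left scaleC_scaleC)

text \<open>Inner products are linear in the first and conjugate-linear in the second argument.
  Hermitian symmetry makes \<open>g x x\<close> real, so its real part carries positivity.\<close>

definition (in complex_vector) inner_product :: "('a \<Rightarrow> 'a \<Rightarrow> complex) \<Rightarrow> bool" where
  "inner_product g \<longleftrightarrow>
     (\<forall>x y z. g (x + y) z = g x z + g y z) \<and>
     (\<forall>c x y. g (c *\<^sub>C x) y = c * g x y) \<and>
     (\<forall>x y. g y x = cnj (g x y)) \<and>
     (\<forall>x. x \<noteq> 0 \<longrightarrow> 0 < Re (g x x))"

text \<open>A complex Hilbert space carries the real inner product \<open>Re \<langle>x, y\<rangle>\<close>, which induces the
  same norm; this gives access to the library's norm, topology and completeness.\<close>

class complex_hilbert = complex_vector + real_inner + complete_space +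
  fixes cinner :: "'a \<Rightarrow> 'a \<Rightarrow> complex"
  assumes inner_product_cinner: "inner_product cinner"
    and inner_eq_Re_cinner: "inner x y = Re (cinner x y)"

definition bounded_clinear :: "('a::complex_hilbert \<Rightarrow> 'a) \<Rightarrow> bool" where
  "bounded_clinear T \<longleftrightarrow> bounded_linear T \<and> (\<forall>c x. T (c *\<^sub>C x) = c *\<^sub>C T x)"

definition induced_norm :: "('a \<Rightarrow> 'a \<Rightarrow> complex) \<Rightarrow> 'a \<Rightarrow> real" where
  "induced_norm g x = sqrt (Re (g x x))"

definition equivalent_norms :: "('a \<Rightarrow> real) \<Rightarrow> ('a \<Rightarrow> real) \<Rightarrow> bool" where
  "equivalent_norms N N' \<longleftrightarrow> (\<exists>c > 0. \<exists>C > 0. \<forall>x. c * N x \<le> N' x \<and> N' x \<le> C * N x)"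

text \<open>An equivalent Hilbert norm is represented by the inner product inducing it, which the norm
  determines by polarization.\<close>

definition equivalent_hilbert_norm :: "('a::complex_hilbert \<Rightarrow> 'a \<Rightarrow> complex) \<Rightarrow> bool" where
  "equivalent_hilbert_norm g \<longleftrightarrow> inner_product g \<and> equivalent_norms norm (induced_norm g)"

text \<open>The adjoint of \<open>T\<close> for the inner product \<open>g\<close>. For \<open>T\<close> bounded and \<open>g\<close> inducing an
  equivalent (hence complete) norm it exists by the Riesz representation theorem, and it is unique
  because \<open>g\<close> is nondegenerate.\<close>

definition adjoint_wrt :: "('a \<Rightarrow> 'a \<Rightarrow> complex) \<Rightarrow> ('a \<Rightarrow> 'a) \<Rightarrow> 'a \<Rightarrow> 'a" where
  "adjoint_wrt g T = (THE S. \<forall>x y. g (T x) y = g x (S y))"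

definition beta ::
  "('a::complex_vector \<Rightarrow> 'a \<Rightarrow> complex) \<Rightarrow> nat \<Rightarrow> ('a \<Rightarrow> 'a) \<Rightarrow> 'a \<Rightarrow> 'a" where
  "beta g m T x =
     (\<Sum>k=0..m. ((-1) ^ (m - k) * of_nat (m choose k)) *\<^sub>C (adjoint_wrt g T ^^ k) ((T ^^ k) x))"

definition m_isometry_wrt ::
  "('a::complex_vector \<Rightarrow> 'a \<Rightarrow> complex) \<Rightarrow> nat \<Rightarrow> ('a \<Rightarrow> 'a) \<Rightarrow> bool" where
  "m_isometry_wrt g m T \<longleftrightarrow> (\<forall>x. beta g m T x = 0)"

definition m_partial_isometry_wrt ::
  "('a::complex_vector \<Rightarrow> 'a \<Rightarrow> complex) \<Rightarrow> nat \<Rightarrow> ('a \<Rightarrow> 'a) \<Rightarrow> bool" where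
  "m_partial_isometry_wrt g m T \<longleftrightarrow> (\<forall>x. T (beta g m T x) = 0)"

abbreviation m_isometry :: "nat \<Rightarrow> ('a::complex_hilbert \<Rightarrow> 'a) \<Rightarrow> bool" where
  "m_isometry \<equiv> m_isometry_wrt cinner"

abbreviation m_partial_isometry :: "nat \<Rightarrow> ('a::complex_hilbert \<Rightarrow> 'a) \<Rightarrow> bool" where
  "m_partial_isometry \<equiv> m_partial_isometry_wrt cinner"

text \<open>\<open>Q\<close> is the inverse of \<open>P\<close>.\<close>

definition similar_operators ::
  "('a::complex_hilbert \<Rightarrow> 'a) \<Rightarrow> ('a \<Rightarrow> 'a) \<Rightarrow> bool" where
  "similar_operators A B \<longleftrightarrow>
     (\<exists>P Q. bounded_clinear P \<and> bounded_clinear Q \<and> P \<circ> Q = id \<and> Q \<circ> P = id \<and> A = Q \<circ> B \<circ> P)"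

end

theory Submission
  imports Defs
begin

text \<open>If \<open>T = P\<inverse> A P\<close>, then \<open>T\<close> behaves for the inner product \<open>\<langle>P x, P y\<rangle>\<close> exactly as \<open>A\<close> does for
  the original one: the two adjoints, and hence the two operators \<open>\<beta>\<^sub>m\<close>, are conjugate under \<open>P\<close>.
  Conversely, every inner product inducing an equivalent norm has this form. By the Riesz theorem it
  is \<open>\<langle>G x, y\<rangle>\<close> with \<open>G\<close> selfadjoint and \<open>c\<^sup>2 \<le> G \<le> C\<^sup>2\<close>, and \<open>P\<close> is a square root of \<open>G\<close>, namely
  \<open>C (I - Y)\<close> where \<open>Y\<close> is the fixed point of the contraction \<open>Y \<mapsto> (I - G/C\<^sup>2 + Y\<^sup>2)/2\<close>.\<close>

\<comment> \<open>The contraction arguments below take place in the space itself and in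
  \<open>'a \<Rightarrow>\<^sub>L 'a\<close>, which is complete because its target is a Banach
  space.\<close>
subclass (in complex_hilbert) banach ..

section \<open>Inner products and uniqueness of adjoints\<close>

lemma inner_product_simps:
  assumes "inner_product g"
  shows "g (x + y) z = g x z + g y z" "g (c *\<^sub>C x) y = c * g x y" "g y x = cnj (g x y)"
    "x \<noteq> 0 \<Longrightarrow> 0 < Re (g x x)"
  using assms unfolding inner_product_def by blast+

lemma inner_product_right:
  assumes "inner_product g"
  shows "g x (y + z) = g x y + g x z" "g x (c *\<^sub>C y) = cnj c * g x y"
proof -
  note g = inner_product_simps[OF assms]
  show "g x (y + z) = g x y + g x z"
    by (subst (1 2 3) g(3)) (simp add: g(1))
  show "g x (c *\<^sub>C y) = cnj c * g x y"
    by (subst (1 2) g(3)) (simp add: g(2))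
qed

lemma inner_product_scaleR:
  assumes "inner_product g"
  shows "g (r *\<^sub>R x) y = of_real r * g x y" "g x (r *\<^sub>R y) = of_real r * g x y"
  using inner_product_simps(2)[OF assms] inner_product_right(2)[OF assms]
  by (simp_all add: scaleR_scaleC)

lemma inner_product_diff_right:
  assumes "inner_product g"
  shows "g x (y - z) = g x y - g x z"
  using inner_product_right(1)[OF assms, of x "y - z" z] by simp

text \<open>Since \<open>Re (g (\<i> x) y) = - Im (g x y)\<close>, an inner product is determined by its real part.\<close>

lemma inner_product_eqI:
  assumes "inner_product g" "inner_product h"
    and "Re (g x y) = Re (h u v)" "Re (g (\<i> *\<^sub>C x) y) = Re (h (\<i> *\<^sub>C u) v)"
  shows "g x y = h u v"
  using assms(3,4)
  by (simp add: inner_product_simps(2)[OF assms(1)] inner_product_simps(2)[OF assms(2)] complex_eq_iff)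

lemma inner_product_eqI_right:
  assumes "inner_product g" "inner_product h"
    and "Re (g x y) = Re (h u v)" "Re (g x (\<i> *\<^sub>C y)) = Re (h u (\<i> *\<^sub>C v))"
  shows "g x y = h u v"
  using assms(3,4)
  by (simp add: inner_product_right(2)[OF assms(1)] inner_product_right(2)[OF assms(2)] complex_eq_iff)

text \<open>Testing \<open>g\<close> against the difference of two candidates forces them to agree,
  by definiteness. Exhibiting one candidate thus resolves the \<open>THE\<close> in
  \<open>adjoint_wrt\<close>.\<close>

lemma adjoint_wrt_eqI:
  assumes g: "inner_product g" and S: "\<And>x y. g (T x) y = g x (S y)"
  shows "adjoint_wrt g T = S"
  unfolding adjoint_wrt_def
proof (rule the_equality)
  show "\<forall>x y. g (T x) y = g x (S y)"
    using S by blast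
next
  fix R assume R: "\<forall>x y. g (T x) y = g x (R y)"
  show "R = S"
  proof
    fix y
    have "g (R y - S y) (R y - S y) = 0"
      using R S by (simp add: inner_product_diff_right[OF g])
    then show "R y = S y"
      using inner_product_simps(4)[OF g, of "R y - S y"] by fastforce
  qed
qed

section \<open>Complex scalars as bounded operators\<close>

lemma norm_scaleC: "norm (c *\<^sub>C x) = cmod c * norm (x::'a::complex_hilbert)"
proof -
  have "cinner (c *\<^sub>C x) (c *\<^sub>C x) = of_real ((cmod c)\<^sup>2) * cinner x x"
    unfolding complex_norm_square
    by (simp add: inner_product_simps(2)[OF inner_product_cinner]
        inner_product_right(2)[OF inner_product_cinner])
  then have "(norm (c *\<^sub>C x))\<^sup>2 = (cmod c * norm x)\<^sup>2"
    by (simp add: power2_norm_eq_inner inner_eq_Re_cinner power_mult_distrib)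
  then show ?thesis
    by simp
qed

lemma bounded_linear_scaleC: "bounded_linear ((*\<^sub>C) c :: 'a::complex_hilbert \<Rightarrow> 'a)"
  by (rule bounded_linear_intro[where K = "cmod c"])
    (simp_all add: scaleC_add_right scaleR_scaleC scaleC_scaleC norm_scaleC mult.commute)

lemma scaleC_zero_right: "c *\<^sub>C (0::'a::complex_hilbert) = 0"
  using linear_0[OF bounded_linear.linear[OF bounded_linear_scaleC]] .

lemma scaleC_diff_right: "c *\<^sub>C (x - y) = c *\<^sub>C x - c *\<^sub>C (y::'a::complex_hilbert)"
  using linear_diff[OF bounded_linear.linear[OF bounded_linear_scaleC]] .

lemma bounded_clinear_compose:
  assumes "bounded_clinear S" "bounded_clinear T"
  shows "bounded_clinear (S \<circ> T)"
  using assms bounded_linear_compose[of S T] unfolding bounded_clinear_def comp_def by auto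

subsection \<open>Riesz representation\<close>

text \<open>The representing vector minimizes \<open>J\<close>. Minimizing sequences are Cauchy by the parallelogram
  law.\<close>

lemma Riesz_representation:
  fixes f :: "'a::{real_inner, complete_space} \<Rightarrow> real"
  assumes f: "bounded_linear f"
  shows "\<exists>z. \<forall>x. f x = inner z x"
proof -
  interpret f: bounded_linear f by fact
  \<comment> \<open>If \<open>z\<close> represents \<open>f\<close>, then \<open>J x\<close> is
    \<open>(norm (x - z))^2 - (norm z)^2\<close>, which is smallest exactly at
    \<open>z\<close>.\<close>
  define J where "J x = inner x x - 2 * f x" for x
  obtain K where K: "\<And>x. \<bar>f x\<bar> \<le> norm x * K"
    using f.bounded by auto
  have "J x \<ge> - (K\<^sup>2)" for x
  proof -
    \<comment> \<open>Completing the square: \<open>J x\<close> is at least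
      \<open>(norm x)^2 - 2 * K * norm x\<close>.\<close>
    have "0 \<le> (norm x - K)\<^sup>2" by simp
    then show ?thesis
      using K[of x] by (simp add: J_def power2_diff power2_norm_eq_inner)
  qed
  then have bdd: "bdd_below (range J)"
    by (meson bdd_belowI2)
  define I where "I = Inf (range J)"
  have I_le: "I \<le> J x" for x
    unfolding I_def by (rule cInf_lower) (auto intro: bdd)
  have "\<exists>x. J x < I + inverse (real (Suc n))" for n
  proof -
    have "Inf (range J) < I + inverse (real (Suc n))" by (simp add: I_def)
    from cInf_lessD[OF _ this] show ?thesis by auto
  qed
  then obtain X where X: "\<And>n. J (X n) < I + inverse (real (Suc n))"
    by metis
  have parallelogram: "J x + J y = 2 * J ((1/2) *\<^sub>R (x + y)) + inner (x - y) (x - y) / 2" for x y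
    by (simp add: J_def f.add f.scaleR inner_diff inner_add inner_commute algebra_simps field_simps)
  \<comment> \<open>Both values of \<open>J\<close> exceed \<open>I\<close> by at most
    \<open>1 / (N + 1)\<close>, while the value at the midpoint is at least \<open>I\<close>. So
    half the squared distance is at most \<open>2 / (N + 1)\<close>.\<close>
  have close: "(norm (X m - X n))\<^sup>2 \<le> 4 * inverse (real (Suc N))" if "m \<ge> N" "n \<ge> N" for m n N
  proof -
    have "inverse (real (Suc k)) \<le> inverse (real (Suc N))" if "k \<ge> N" for k
      using that by (intro le_imp_inverse_le) auto
    then show ?thesis
      using X[of m] X[of n] parallelogram[of "X m" "X n"] I_le[of "(1/2) *\<^sub>R (X m + X n)"] that
      unfolding power2_norm_eq_inner by (smt (verit, best) field_sum_of_halves)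
  qed
  have "Cauchy X"
  proof (rule metric_CauchyI)
    fix e :: real assume "e > 0"
    then obtain N where N: "inverse (real (Suc N)) < e\<^sup>2 / 4"
      using reals_Archimedean[of "e\<^sup>2 / 4"] by auto
    have "dist (X m) (X n) < e" if "m \<ge> N" "n \<ge> N" for m n
    proof -
      have "(norm (X m - X n))\<^sup>2 < e\<^sup>2"
        using close[OF that] N by linarith
      then show ?thesis
        using \<open>e > 0\<close> by (simp add: dist_norm power2_less_imp_less)
    qed
    then show "\<exists>M. \<forall>m\<ge>M. \<forall>n\<ge>M. dist (X m) (X n) < e" by blast
  qed
  then obtain z where z: "X \<longlonglongrightarrow> z"
    using Cauchy_convergent convergent_def by blast
  have "(\<lambda>n. J (X n)) \<longlonglongrightarrow> J z"
    unfolding J_def by (intro tendsto_intros f.tendsto z)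
  moreover have "(\<lambda>n. I + inverse (real (Suc n))) \<longlonglongrightarrow> I + 0"
    by (intro tendsto_intros LIMSEQ_inverse_real_of_nat)
  ultimately have Jz: "J z \<le> I"
    using X by (intro LIMSEQ_le) (auto intro: less_imp_le)
  have "f x = inner z x" for x
  proof (cases "x = 0")
    case False
    then have pos: "inner x x > 0" by simp
    \<comment> \<open>\<open>2 * d\<close> is the derivative of \<open>J\<close> at \<open>z\<close>
      in direction \<open>x\<close>, and \<open>t\<close> minimizes the quadratic
      \<open>J (z + t x)\<close>. A nonzero \<open>d\<close> would push \<open>J\<close> below its
      minimum.\<close>
    define d where "d = inner z x - f x"
    define t where "t = - d / inner x x"
    have "J z \<le> J (z + t *\<^sub>R x)"
      using Jz I_le order_trans by blast
    also have "J (z + t *\<^sub>R x) = J z + t\<^sup>2 * inner x x + 2 * t * d"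
      by (simp add: J_def d_def f.add f.scaleR inner_add inner_commute algebra_simps power2_eq_square)
    also have "\<dots> = J z - d\<^sup>2 / inner x x"
      using pos by (simp add: t_def field_simps power2_eq_square)
    finally have "d\<^sup>2 \<le> 0"
      using pos by (simp add: divide_le_0_iff)
    then show ?thesis by (simp add: d_def)
  qed simp
  then show ?thesis by blast
qed

text \<open>Riesz, applied for each \<open>y\<close> separately, gives an adjoint for the real inner
  product. Evaluating it at \<open>\<i> x\<close> too, where complex linearity of \<open>A\<close>
  enters, recovers the imaginary part.\<close>

lemma adjoint_exists:
  fixes A :: "'a::complex_hilbert \<Rightarrow> 'a"
  assumes A: "bounded_clinear A"
  shows "\<exists>S. \<forall>x y. cinner (A x) y = cinner x (S y)"
proof -
  interpret A: bounded_linear A using A by (simp add: bounded_clinear_def)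
  have "\<exists>z. \<forall>x. inner (A x) y = inner z x" for y
    by (rule Riesz_representation)
      (rule bounded_linear_compose[OF bounded_linear_inner_left A.bounded_linear_axioms])
  then obtain S where S: "\<And>x y. inner (A x) y = inner x (S y)"
    by (metis inner_commute)
  have "cinner (A x) y = cinner x (S y)" for x y
    using A S[of x y] S[of "\<i> *\<^sub>C x" y]
    by (intro inner_product_eqI inner_product_cinner)
      (simp_all add: inner_eq_Re_cinner bounded_clinear_def)
  then show ?thesis by blast
qed

subsection \<open>Transport along an invertible operator\<close>

lemma funpow_conjugate:
  assumes "P \<circ> Q = id" "Q \<circ> P = id"
  shows "(Q \<circ> A \<circ> P) ^^ n = Q \<circ> A ^^ n \<circ> P"
proof (induction n)
  case (Suc n)
  have "P (Q x) = x" for x using assms(1) by (metis comp_apply id_apply)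
  then show ?case unfolding funpow.simps(2) Suc by (simp add: fun_eq_iff)
qed (simp add: assms)

lemma inner_product_pullback:
  fixes P :: "'a::complex_hilbert \<Rightarrow> 'a"
  assumes P: "bounded_clinear P" and QP: "Q \<circ> P = id"
  shows "inner_product (\<lambda>x y. cinner (P x) (P y))"
proof -
  interpret P: bounded_linear P using P by (simp add: bounded_clinear_def)
  note c = inner_product_simps[OF inner_product_cinner]
  have "P x \<noteq> 0" if "x \<noteq> 0" for x
    using that QP P.zero by (metis comp_apply id_apply)
  then show ?thesis
    using P c(3) unfolding inner_product_def bounded_clinear_def
    by (auto simp: P.add c(1,2) c(4))
qed

text \<open>The new norm of \<open>x\<close> is \<open>norm (P x)\<close>. A bound for
  \<open>P\<close> gives the upper constant; a bound for \<open>Q\<close>, applied to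
  \<open>x = Q (P x)\<close>, gives the lower one.\<close>

lemma equivalent_hilbert_norm_pullback:
  fixes P Q :: "'a::complex_hilbert \<Rightarrow> 'a"
  assumes P: "bounded_clinear P" and Q: "bounded_clinear Q" and QP: "Q \<circ> P = id"
  shows "equivalent_hilbert_norm (\<lambda>x y. cinner (P x) (P y))"
proof -
  obtain K where K: "K > 0" "\<And>x. norm (P x) \<le> norm x * K"
    using P bounded_linear.pos_bounded unfolding bounded_clinear_def by blast
  obtain L where L: "L > 0" "\<And>x. norm (Q x) \<le> norm x * L"
    using Q bounded_linear.pos_bounded unfolding bounded_clinear_def by blast
  have norm_P: "induced_norm (\<lambda>x y. cinner (P x) (P y)) x = norm (P x)" for x
    by (simp add: induced_norm_def norm_eq_sqrt_inner inner_eq_Re_cinner)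
  have "norm x \<le> norm (P x) * L" for x
    using L(2)[of "P x"] QP by (metis comp_apply id_apply)
  then have "inverse L * norm x \<le> norm (P x) \<and> norm (P x) \<le> K * norm x" for x
    using K(2)[of x] L(1) by (simp add: field_simps)
  then have "equivalent_norms norm (induced_norm (\<lambda>x y. cinner (P x) (P y)))"
    unfolding equivalent_norms_def norm_P using K(1) L(1)
    by (meson positive_imp_inverse_positive)
  then show ?thesis
    using inner_product_pullback[OF P QP] by (simp add: equivalent_hilbert_norm_def)
qed

text \<open>If \<open>S\<close> is the adjoint of \<open>A\<close>, then
  \<open>Q \<circ> S \<circ> P\<close> is the adjoint of \<open>Q \<circ> A \<circ> P\<close> for
  the pulled-back form. The inner factors \<open>P \<circ> Q\<close> cancel in all powers and
  products, and linearity takes \<open>Q\<close> out of the sum.\<close>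

lemma beta_pullback:
  fixes P Q A :: "'a::complex_hilbert \<Rightarrow> 'a"
  assumes P: "bounded_clinear P" and Q: "bounded_clinear Q" and A: "bounded_clinear A"
    and PQ: "P \<circ> Q = id" and QP: "Q \<circ> P = id"
  shows "beta (\<lambda>x y. cinner (P x) (P y)) m (Q \<circ> A \<circ> P) x = Q (beta cinner m A (P x))"
proof -
  interpret Q: bounded_linear Q using Q by (simp add: bounded_clinear_def)
  have PQ': "P (Q y) = y" for y using PQ by (metis comp_apply id_apply)
  obtain S where S: "\<And>x y. cinner (A x) y = cinner x (S y)"
    using adjoint_exists[OF A] by blast
  have "adjoint_wrt (\<lambda>x y. cinner (P x) (P y)) (Q \<circ> A \<circ> P) = Q \<circ> S \<circ> P"
    by (rule adjoint_wrt_eqI[OF inner_product_pullback[OF P QP]]) (simp add: PQ' S)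
  moreover have "adjoint_wrt cinner A = S"
    by (rule adjoint_wrt_eqI[OF inner_product_cinner S])
  moreover have "Q (c *\<^sub>C y) = c *\<^sub>C Q y" for c y
    using Q by (simp add: bounded_clinear_def)
  ultimately show ?thesis
    by (simp add: beta_def funpow_conjugate[OF PQ QP] PQ' Q.sum)
qed

text \<open>In \<open>beta_pullback\<close> the outer \<open>Q\<close> is injective and the inner
  \<open>P\<close> is surjective, so neither affects vanishing for all vectors. In the partial case
  one more pair \<open>P \<circ> Q\<close> cancels.\<close>

lemma m_isometry_pullback:
  fixes P Q A :: "'a::complex_hilbert \<Rightarrow> 'a"
  assumes P: "bounded_clinear P" and Q: "bounded_clinear Q" and A: "bounded_clinear A"
    and PQ: "P \<circ> Q = id" and QP: "Q \<circ> P = id"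
  shows "m_isometry_wrt (\<lambda>x y. cinner (P x) (P y)) m (Q \<circ> A \<circ> P) \<longleftrightarrow> m_isometry m A"
    and "m_partial_isometry_wrt (\<lambda>x y. cinner (P x) (P y)) m (Q \<circ> A \<circ> P) \<longleftrightarrow>
      m_partial_isometry m A"
proof -
  have PQ': "P (Q y) = y" for y using PQ by (metis comp_apply id_apply)
  have "Q 0 = 0"
    using Q by (simp add: bounded_clinear_def linear_simps)
  moreover have "P 0 = 0"
    using P by (simp add: bounded_clinear_def linear_simps)
  ultimately have Q0: "Q y = 0 \<longleftrightarrow> y = 0" for y
    using PQ' by metis
  show "m_isometry_wrt (\<lambda>x y. cinner (P x) (P y)) m (Q \<circ> A \<circ> P) \<longleftrightarrow> m_isometry m A"
    unfolding m_isometry_wrt_def beta_pullback[OF assms] Q0 by (metis PQ')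
  show "m_partial_isometry_wrt (\<lambda>x y. cinner (P x) (P y)) m (Q \<circ> A \<circ> P) \<longleftrightarrow>
      m_partial_isometry m A"
    unfolding m_partial_isometry_wrt_def beta_pullback[OF assms] comp_apply PQ' Q0 by (metis PQ')
qed

subsection \<open>Square roots\<close>

text \<open>Polarization and the parallelogram law bound \<open>h x y\<close> by \<open>K\<close>
  times the mean of the squared norms, which is \<open>K\<close> on unit vectors; scaling does the
  rest. As \<open>h\<close> may be indefinite, this replaces Cauchy-Schwarz.\<close>

lemma symmetric_bilinear_bound:
  fixes h :: "'a::real_inner \<Rightarrow> 'a \<Rightarrow> real"
  assumes add: "\<And>x y z. h (x + y) z = h x z + h y z"
    and scale: "\<And>r x y. h (r *\<^sub>R x) y = r * h x y"
    and sym: "\<And>x y. h x y = h y x"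
    and quad: "\<And>x. \<bar>h x x\<bar> \<le> K * (norm x)\<^sup>2"
  shows "\<bar>h x y\<bar> \<le> K * norm x * norm y"
proof -
  have add': "h x (y + z) = h x y + h x z" for x y z
    using add sym by metis
  have scale': "h x (r *\<^sub>R y) = r * h x y" for r x y
    using scale sym by metis
  have minus: "h x (- y) = - h x y" "h (- x) y = - h x y" for x y
    using scale'[of x "-1" y] scale[of "-1" x y] by simp_all
  have diff: "h (x - y) (x - y) = h x x + h y y - 2 * h x y" for x y
    using add[of x "- y" "x - y"] add'[of x x "- y"] add'[of "- y" x "- y"] sym[of y x]
    by (simp add: minus)
  have polar: "\<bar>h x y\<bar> \<le> K * ((norm x)\<^sup>2 + (norm y)\<^sup>2) / 2" for x y
  proof -
    have "4 * h x y = h (x + y) (x + y) - h (x - y) (x - y)"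
      unfolding diff using add[of x y "x + y"] add'[of x x y] add'[of y x y] sym[of y x] by simp
    moreover have "K * (norm (x + y))\<^sup>2 + K * (norm (x - y))\<^sup>2
        = 2 * (K * ((norm x)\<^sup>2 + (norm y)\<^sup>2))"
      by (simp add: power2_norm_eq_inner inner_add inner_diff inner_commute algebra_simps)
    ultimately show ?thesis
      using quad[of "x + y"] quad[of "x - y"] by linarith
  qed
  show ?thesis
  proof (cases "x = 0 \<or> y = 0")
    case True
    then show ?thesis using scale[of 0 x y] scale'[of x 0 y] by auto
  next
    case False
    have unit: "\<bar>h u v\<bar> \<le> K" if "norm u = 1" "norm v = 1" for u v
      using polar[of u v] that by simp
    have "\<bar>h ((1 / norm x) *\<^sub>R x) ((1 / norm y) *\<^sub>R y)\<bar> \<le> K"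
      using False by (intro unit) simp_all
    then have "\<bar>h x y / (norm x * norm y)\<bar> \<le> K"
      by (simp add: scale scale' mult.commute)
    then show ?thesis
      using False by (simp add: field_simps)
  qed
qed

text \<open>Evaluation at a vector is continuous in the operator norm, so each condition is closed.
  This supplies the complete domain for the fixed point in \<open>selfadjoint_sqrt\<close>.\<close>

lemma closed_selfadjoint_clinear:
  "closed {Y :: 'a::complex_hilbert \<Rightarrow>\<^sub>L 'a. norm Y \<le> r \<and>
     (\<forall>x y. inner (blinfun_apply Y x) y = inner x (blinfun_apply Y y)) \<and>
     (\<forall>c x. blinfun_apply Y (c *\<^sub>C x) = c *\<^sub>C blinfun_apply Y x)}"
proof -
  have apply_cont: "continuous_on UNIV (\<lambda>Y :: 'a \<Rightarrow>\<^sub>L 'a. Y x)" for x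
    by (intro continuous_intros)
  have "continuous_on UNIV (\<lambda>Y :: 'a \<Rightarrow>\<^sub>L 'a. c *\<^sub>C Y x)" for c x
    by (rule bounded_linear.continuous_on[OF bounded_linear_scaleC apply_cont])
  then show ?thesis
    by (intro closed_Collect_conj closed_Collect_all closed_Collect_eq closed_Collect_le
        continuous_intros)
qed

text \<open>The equation \<open>(I - Y)^2 = I - B\<close> rearranges to
  \<open>Y = (B + Y^2) / 2\<close>. Iterating inside the selfadjoint complex-linear operators of
  norm at most \<open>1 - e\<close> puts these properties on the fixed point itself.\<close>

lemma selfadjoint_sqrt:
  fixes B :: "'a::complex_hilbert \<Rightarrow>\<^sub>L 'a"
  assumes e: "0 < e" "e \<le> 1" and B: "norm B \<le> 1 - e\<^sup>2"
    and sym: "\<And>x y. inner (B x) y = inner x (B y)"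
    and lin: "\<And>c x. B (c *\<^sub>C x) = c *\<^sub>C B x"
  shows "\<exists>Y :: 'a \<Rightarrow>\<^sub>L 'a. norm Y \<le> 1 - e \<and>
    (\<forall>x y. inner (blinfun_apply Y x) y = inner x (blinfun_apply Y y)) \<and>
    (\<forall>c x. blinfun_apply Y (c *\<^sub>C x) = c *\<^sub>C blinfun_apply Y x) \<and>
    (\<forall>x. (x - blinfun_apply Y x) - blinfun_apply Y (x - blinfun_apply Y x) = x - B x)"
proof -
  define S where "S = {Y :: 'a \<Rightarrow>\<^sub>L 'a. norm Y \<le> 1 - e \<and>
     (\<forall>x y. inner (blinfun_apply Y x) y = inner x (blinfun_apply Y y)) \<and>
     (\<forall>c x. blinfun_apply Y (c *\<^sub>C x) = c *\<^sub>C blinfun_apply Y x)}"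
  define F where "F Y = (1/2) *\<^sub>R (B + (Y o\<^sub>L Y))" for Y :: "'a \<Rightarrow>\<^sub>L 'a"
  have F_apply: "F Y x = (1/2) *\<^sub>R (B x + Y (Y x))" for Y x
    by (simp add: F_def blinfun.add_left blinfun.scaleR_left)
  have F_S: "F Y \<in> S" if "Y \<in> S" for Y
  proof -
    have Y: "norm Y \<le> 1 - e" "\<And>x y. inner (Y x) y = inner x (Y y)" "\<And>c x. Y (c *\<^sub>C x) = c *\<^sub>C Y x"
      using that by (auto simp: S_def)
    have "norm (Y o\<^sub>L Y) \<le> norm Y * norm Y" by (rule norm_blinfun_compose)
    also have "\<dots> \<le> (1 - e) * (1 - e)" using Y(1) e by (intro mult_mono) auto
    finally have "norm (B + (Y o\<^sub>L Y)) \<le> (1 - e\<^sup>2) + (1 - e) * (1 - e)"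
      using B norm_triangle_ineq[of B "Y o\<^sub>L Y"] by linarith
    \<comment> \<open>The bound on \<open>B\<close> is tuned to this identity: after halving, the
      ball of radius \<open>1 - e\<close> is mapped into itself.\<close>
    also have "\<dots> = 2 * (1 - e)" by (simp add: algebra_simps power2_eq_square)
    finally have "norm (F Y) \<le> 1 - e" by (simp add: F_def)
    moreover have "F Y (c *\<^sub>C x) = c *\<^sub>C F Y x" for c x
      by (simp add: F_apply lin Y(3) scaleC_add_right scaleR_scaleC scaleC_scaleC mult.commute)
    ultimately show ?thesis
      by (simp add: S_def F_apply inner_add sym Y(2))
  qed
  have "\<exists>!Y\<in>S. F Y = Y"
  proof (rule Banach_fix)
    show "complete S"
      unfolding S_def by (simp add: complete_eq_closed closed_selfadjoint_clinear)
    have "0 \<in> S"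
      using e by (simp add: S_def scaleC_zero_right)
    then show "S \<noteq> {}" by blast
    show "F ` S \<subseteq> S" using F_S by blast
    fix Y Z assume "Y \<in> S" "Z \<in> S"
    then have YZ: "norm Y \<le> 1 - e" "norm Z \<le> 1 - e" by (auto simp: S_def)
    \<comment> \<open>Difference of squares without commutativity:
      \<open>Y^2 - Z^2 = Y (Y - Z) + (Y - Z) Z\<close>. The factor 1/2 then leaves the Lipschitz
      constant \<open>1 - e\<close>.\<close>
    have "F Y - F Z = (1/2) *\<^sub>R ((Y o\<^sub>L (Y - Z)) + ((Y - Z) o\<^sub>L Z))"
      by (rule blinfun_eqI)
        (simp add: F_apply blinfun.add_left blinfun.diff_left blinfun.diff_right
          blinfun.scaleR_left algebra_simps)
    moreover have "norm ((Y o\<^sub>L (Y - Z)) + ((Y - Z) o\<^sub>L Z)) \<le>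
        norm Y * norm (Y - Z) + norm (Y - Z) * norm Z"
      by (rule norm_triangle_le, rule add_mono) (rule norm_blinfun_compose)+
    moreover have "norm Y * norm (Y - Z) + norm (Y - Z) * norm Z
        \<le> (1 - e) * norm (Y - Z) + norm (Y - Z) * (1 - e)"
      using YZ by (intro add_mono mult_right_mono mult_left_mono) auto
    ultimately show "dist (F Y) (F Z) \<le> (1 - e) * dist Y Z"
      by (simp add: dist_norm)
  qed (use e in auto)
  then obtain Y where Y: "Y \<in> S" "F Y = Y" by blast
  have "(x - Y x) - Y (x - Y x) = x - B x" for x
  proof -
    have "2 *\<^sub>R Y x = B x + Y (Y x)"
      by (subst Y(2)[symmetric]) (simp add: F_apply)
    then show ?thesis
      by (simp add: blinfun.diff_right scaleR_2 algebra_simps)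
  qed
  with Y(1) show ?thesis by (auto simp: S_def)
qed

section \<open>Bounded inverses\<close>

text \<open>A solution is a fixed point of the contraction
  \<open>u \<mapsto> y + Y u\<close>.\<close>

lemma surj_id_minus_contraction:
  fixes Y :: "'a::banach \<Rightarrow>\<^sub>L 'a"
  assumes "norm Y < 1"
  shows "\<exists>x. x - Y x = y"
proof -
  have "\<exists>!x. y + Y x = x"
  proof (rule banach_fix_type[where c = "norm Y"])
    show "\<forall>u v. dist (y + Y u) (y + Y v) \<le> norm Y * dist u v"
      by (simp add: dist_norm norm_blinfun flip: blinfun.diff_right)
  qed (use assms in auto)
  then show ?thesis by (metis add_diff_cancel_right')
qed

text \<open>The lower bound yields injectivity and a bound \<open>1 / c\<close> for the inverse.
  Linearity of \<open>Q\<close> is checked after applying the injective \<open>P\<close>.\<close>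

lemma bounded_clinear_inverse:
  fixes P :: "'a::complex_hilbert \<Rightarrow> 'a"
  assumes P: "bounded_clinear P" and surj: "\<And>y. \<exists>x. P x = y"
    and c: "0 < c" "\<And>x. c * norm x \<le> norm (P x)"
  shows "\<exists>Q. bounded_clinear Q \<and> P \<circ> Q = id \<and> Q \<circ> P = id"
proof -
  interpret P: bounded_linear P using P by (simp add: bounded_clinear_def)
  have inj: "x = y" if "P x = P y" for x y
    using c(2)[of "x - y"] that c(1) by (simp add: P.diff mult_le_0_iff)
  obtain Q where PQ: "\<And>y. P (Q y) = y" using surj by metis
  have QP: "Q (P x) = x" for x by (rule inj) (rule PQ)
  have Qc: "Q (a *\<^sub>C x) = a *\<^sub>C Q x" for a x
    by (rule inj) (use P PQ in \<open>simp add: bounded_clinear_def\<close>)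
  have "bounded_linear Q"
  proof (rule bounded_linear_intro[where K = "inverse c"])
    show "Q (x + y) = Q x + Q y" for x y by (rule inj) (simp add: P.add PQ)
    show "Q (r *\<^sub>R x) = r *\<^sub>R Q x" for r x by (rule inj) (simp add: P.scaleR PQ)
    show "norm (Q x) \<le> norm x * inverse c" for x
      using c(2)[of "Q x"] c(1) by (simp add: PQ field_simps)
  qed
  with PQ QP Qc show ?thesis by (auto simp: bounded_clinear_def fun_eq_iff)
qed

section \<open>Equivalent Hilbert norms as pullbacks\<close>

lemma equivalent_hilbert_norm_imp_pullback:
  fixes g :: "'a::complex_hilbert \<Rightarrow> 'a \<Rightarrow> complex"
  assumes "equivalent_hilbert_norm g"
  shows "\<exists>P Q. bounded_clinear P \<and> bounded_clinear Q \<and> P \<circ> Q = id \<and> Q \<circ> P = id \<and>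
    g = (\<lambda>x y. cinner (P x) (P y))"
proof -
  have g: "inner_product g" using assms by (simp add: equivalent_hilbert_norm_def)
  note gs = inner_product_simps[OF g] inner_product_right[OF g] inner_product_scaleR[OF g]
  note cs = inner_product_simps[OF inner_product_cinner]
  obtain c C0 where c: "c > 0" and "C0 > 0"
    and N: "\<And>x. c * norm x \<le> induced_norm g x" "\<And>x. induced_norm g x \<le> C0 * norm x"
    using assms unfolding equivalent_hilbert_norm_def equivalent_norms_def by blast
  \<comment> \<open>The maximum guarantees \<open>c \<le> C\<close>, hence \<open>e \<le> 1\<close>
    below, even on the zero space, where the norm bounds do not relate \<open>c\<close> and
    \<open>C0\<close>.\<close>
  define C where "C = max c C0"
  have C: "C > 0" "c \<le> C" using c by (auto simp: C_def)
  have g_nonneg: "0 \<le> Re (g x x)" for x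
    using gs(4)[of x] gs(7)[of 0 x x] by (cases "x = 0") auto
  have lower: "c\<^sup>2 * (norm x)\<^sup>2 \<le> Re (g x x)" for x
  proof -
    have "(c * norm x)\<^sup>2 \<le> (induced_norm g x)\<^sup>2"
      using N(1)[of x] c by (intro power_mono) auto
    then show ?thesis using g_nonneg by (simp add: induced_norm_def power_mult_distrib)
  qed
  have upper: "Re (g x x) \<le> C\<^sup>2 * (norm x)\<^sup>2" for x
  proof -
    have "induced_norm g x \<le> C * norm x"
      using N(2)[of x] mult_right_mono[of C0 C "norm x"] by (simp add: C_def)
    then have "(induced_norm g x)\<^sup>2 \<le> (C * norm x)\<^sup>2"
      using g_nonneg by (intro power_mono) (auto simp: induced_norm_def)
    then show ?thesis using g_nonneg by (simp add: induced_norm_def power_mult_distrib)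
  qed
  have g_sym: "Re (g x y) = Re (g y x)" for x y
    by (subst gs(3)) simp
  have g_bound: "\<bar>Re (g x y)\<bar> \<le> C\<^sup>2 * norm x * norm y" for x y
    by (rule symmetric_bilinear_bound[where h = "\<lambda>x y. Re (g x y)"])
      (use g_sym g_nonneg upper in \<open>auto simp: gs(1,7)\<close>)
  have "\<exists>z. \<forall>y. Re (g x y) = inner z y" for x
    by (rule Riesz_representation, rule bounded_linear_intro[where K = "C\<^sup>2 * norm x"])
      (use g_bound[of x] in \<open>auto simp: gs(5,8) algebra_simps\<close>)
  then obtain G where G: "\<And>x y. Re (g x y) = inner (G x) y" by metis
  have g_G: "g x y = cinner (G x) y" for x y
    by (rule inner_product_eqI_right[OF g inner_product_cinner])
      (simp_all add: G inner_eq_Re_cinner)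
  \<comment> \<open>\<open>G\<close> was chosen pointwise; uniqueness of the representing vector
    makes it linear.\<close>
  have G_eqI: "u = G x" if "\<And>y. inner u y = Re (g x y)" for u x
    using that[of "u - G x"] G[of x "u - G x"]
    by (metis inner_diff_left inner_eq_zero_iff right_minus_eq)
  have G_add: "G (x + y) = G x + G y" for x y
    by (rule G_eqI[symmetric]) (simp add: gs(1) G inner_add_left)
  have G_scaleC: "G (a *\<^sub>C x) = a *\<^sub>C G x" for a x
    by (rule G_eqI[symmetric]) (simp only: gs(2) g_G[of x] inner_eq_Re_cinner cs(2))
  have G_scaleR: "G (r *\<^sub>R x) = r *\<^sub>R G x" for r x
    by (simp add: scaleR_scaleC G_scaleC)
  \<comment> \<open>Dividing the bounds on \<open>g\<close> by \<open>C^2\<close> gives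
    \<open>e^2 \<le> G / C^2 \<le> 1\<close>. Hence the form of \<open>B = I - G / C^2\<close> lies
    between 0 and \<open>1 - e^2\<close>, as \<open>selfadjoint_sqrt\<close> requires.\<close>
  define e where "e = c / C"
  have e: "0 < e" "e \<le> 1" using c C by (auto simp: e_def)
  define B where "B x = x - (1 / C\<^sup>2) *\<^sub>R G x" for x
  have B_inner: "inner (B x) y = inner x y - Re (g x y) / C\<^sup>2" for x y
    by (simp add: B_def inner_diff_left G)
  have B_sym: "inner (B x) y = inner x (B y)" for x y
    using B_inner[of x y] B_inner[of y x] by (simp add: g_sym[of x y] inner_commute)
  have B_add: "B (x + y) = B x + B y" for x y
    by (simp add: B_def G_add algebra_simps)
  have B_scaleC: "B (a *\<^sub>C x) = a *\<^sub>C B x" for a x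
    by (simp add: B_def G_scaleC scaleC_diff_right scaleR_scaleC scaleC_scaleC mult.commute)
  have B_scaleR: "B (r *\<^sub>R x) = r *\<^sub>R B x" for r x
    by (simp add: scaleR_scaleC B_scaleC)
  have "\<bar>inner (B x) x\<bar> \<le> (1 - e\<^sup>2) * (norm x)\<^sup>2" for x
  proof -
    have "e\<^sup>2 * (norm x)\<^sup>2 \<le> Re (g x x) / C\<^sup>2"
      using lower[of x] C by (simp add: e_def power_divide divide_right_mono)
    moreover have "Re (g x x) / C\<^sup>2 \<le> (norm x)\<^sup>2"
      using upper[of x] C by (simp add: divide_le_eq mult.commute)
    ultimately show ?thesis
      by (simp add: B_inner power2_norm_eq_inner[symmetric] algebra_simps)
  qed
  then have B_form: "\<bar>inner (B x) y\<bar> \<le> (1 - e\<^sup>2) * norm x * norm y" for x y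
    by (intro symmetric_bilinear_bound[where h = "\<lambda>x y. inner (B x) y"])
      (auto simp: B_add B_scaleR inner_add_left, metis B_sym inner_commute)
  have B_norm: "norm (B x) \<le> (1 - e\<^sup>2) * norm x" for x
  proof (cases "B x = 0")
    case True
    then show ?thesis using e by (simp add: power_le_one)
  next
    case False
    \<comment> \<open>Taking \<open>y = B x\<close> turns the bound on the form into a bound on the
      operator.\<close>
    have "norm (B x) * norm (B x) \<le> (1 - e\<^sup>2) * norm x * norm (B x)"
      using B_form[of x "B x"] by (simp add: power2_norm_eq_inner[symmetric] power2_eq_square)
    then show ?thesis using False by simp
  qed
  have B_bl: "bounded_linear B"
    by (rule bounded_linear_intro[where K = "1 - e\<^sup>2"])
      (use B_norm in \<open>auto simp: B_add B_scaleR mult.commute\<close>)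
  have "norm (Blinfun B) \<le> 1 - e\<^sup>2"
    by (rule norm_blinfun_bound)
      (use e B_norm in \<open>auto simp: bounded_linear_Blinfun_apply[OF B_bl] power_le_one\<close>)
  from selfadjoint_sqrt[OF e this] obtain Y :: "'a \<Rightarrow>\<^sub>L 'a" where
    Y: "norm Y \<le> 1 - e" "\<And>x y. inner (Y x) y = inner x (Y y)"
      "\<And>a x. Y (a *\<^sub>C x) = a *\<^sub>C Y x"
      and sq: "\<And>x. (x - Y x) - Y (x - Y x) = x - B x"
    unfolding bounded_linear_Blinfun_apply[OF B_bl] using B_sym B_scaleC by metis
  define P where "P x = C *\<^sub>R (x - Y x)" for x
  have "bounded_linear P"
    unfolding P_def[abs_def] by (intro bounded_linear_intros)
  moreover have P_scaleC: "P (a *\<^sub>C x) = a *\<^sub>C P x" for a x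
    by (simp add: P_def Y(3) scaleC_diff_right scaleR_scaleC scaleC_scaleC mult.commute)
  ultimately have P: "bounded_clinear P" by (simp add: bounded_clinear_def)
  have P_inner: "inner (P x) (P y) = Re (g x y)" for x y
  proof -
    \<comment> \<open>Selfadjointness of \<open>I - Y\<close> moves both factors to the left, where
      their product is \<open>I - B = G / C^2\<close>.\<close>
    have "inner (P x) (P y) = C\<^sup>2 * inner ((x - Y x) - Y (x - Y x)) y"
      by (simp add: P_def power2_eq_square inner_diff Y(2) algebra_simps)
    also have "\<dots> = C\<^sup>2 * inner (x - B x) y"
      by (simp only: sq)
    also have "\<dots> = Re (g x y)"
      using C by (simp add: inner_diff_left B_inner)
    finally show ?thesis .
  qed
  have g_P: "g x y = cinner (P x) (P y)" for x y
    by (rule inner_product_eqI[OF g inner_product_cinner])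
      (simp_all add: P_inner flip: inner_eq_Re_cinner P_scaleC)
  have P_lower: "c * norm x \<le> norm (P x)" for x
  proof (rule power2_le_imp_le)
    show "(c * norm x)\<^sup>2 \<le> (norm (P x))\<^sup>2"
      using lower[of x] unfolding power2_norm_eq_inner P_inner
      by (simp add: power_mult_distrib power2_norm_eq_inner)
  qed simp
  have "\<exists>x. P x = y" for y
  proof -
    obtain x where "x - Y x = (1 / C) *\<^sub>R y"
      using surj_id_minus_contraction[of Y] Y(1) e by fastforce
    then show ?thesis using C by (intro exI[of _ x]) (simp add: P_def)
  qed
  from bounded_clinear_inverse[OF P this c P_lower] P g_P show ?thesis by blast
qed

section \<open>The two equivalences\<close>

theorem theorem5p1:
  fixes T :: "'a::complex_hilbert \<Rightarrow> 'a" and m :: nat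
  assumes "m \<ge> 1" and "bounded_clinear T"
  shows "((\<exists>A. bounded_clinear A \<and> m_isometry m A \<and> similar_operators T A) \<longleftrightarrow>
            (\<exists>g. equivalent_hilbert_norm g \<and> m_isometry_wrt g m T)) \<and>
         ((\<exists>A. bounded_clinear A \<and> m_partial_isometry m A \<and> similar_operators T A) \<longleftrightarrow>
            (\<exists>g. equivalent_hilbert_norm g \<and> m_partial_isometry_wrt g m T))"
proof -
  \<comment> \<open>For a given \<open>A\<close>, one inner product serves both statements;
    conversely, in \<open>backward\<close> one \<open>A\<close> serves both for a given
    \<open>g\<close>.\<close>
  have forward: "\<exists>g. equivalent_hilbert_norm g \<and> (m_isometry_wrt g m T \<longleftrightarrow> m_isometry m A) \<and>
      (m_partial_isometry_wrt g m T \<longleftrightarrow> m_partial_isometry m A)"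
    if "bounded_clinear A" "similar_operators T A" for A
    using that equivalent_hilbert_norm_pullback m_isometry_pullback
    unfolding similar_operators_def by metis
  have backward: "\<exists>A. bounded_clinear A \<and> similar_operators T A \<and>
      (m_isometry_wrt g m T \<longleftrightarrow> m_isometry m A) \<and>
      (m_partial_isometry_wrt g m T \<longleftrightarrow> m_partial_isometry m A)"
    if norm: "equivalent_hilbert_norm g" for g
  proof -
    obtain P Q where PQ: "bounded_clinear P" "bounded_clinear Q" "P \<circ> Q = id" "Q \<circ> P = id"
      and g: "g = (\<lambda>x y. cinner (P x) (P y))"
      using equivalent_hilbert_norm_imp_pullback[OF norm] by blast
    \<comment> \<open>\<open>P\<close> maps the space with inner product \<open>g\<close>
      isometrically onto the space with \<open>cinner\<close>; \<open>A\<close> is \<open>T\<close>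
      carried over by it.\<close>
    define A where "A = P \<circ> T \<circ> Q"
    have A: "bounded_clinear A"
      unfolding A_def by (intro bounded_clinear_compose PQ assms)
    have T: "T = Q \<circ> A \<circ> P"
      unfolding A_def using PQ(4) by (metis comp_assoc comp_id id_comp)
    have "similar_operators T A"
      unfolding similar_operators_def using PQ T by blast
    with A m_isometry_pullback[OF PQ(1,2) A PQ(3,4), folded g T] show ?thesis
      by blast
  qed
  show ?thesis
    using forward backward by meson
qed

end
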